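(* For all $n\ge 6$ the regular canonical $\mathcal{R}$-cross-section $\Lambda$ and the alternating canonical $\mathcal{R}$-cross-section $\Gamma$ of $\mathfrak{B}_n$ are not isomorphic as monoids.
   Context: Let $M=\{1,\dots,n\}$, $M'=\{1',\dots,n'\}$. The Brauer semigroup $\mathfrak{B}_n$ is the set of all partitions of $M\cup M'$ into two-element subsets; write $a\equiv_\alpha b$ if $\{a,b\}\in\alpha$. The product $\alpha\beta$ is obtained by drawing $\alpha$ to the left of $\beta$ ($M$ = left pins, $M'$ = right pins), identifying each right pin $a'$ of $\alpha$ with the left pin $a$ of $\beta$, pairing the left pins of $\alpha$ and right pins of $\beta$ that are joined by a path, and discarding closed loops. $\mathfrak{B}_n$ is a monoid. $\mathrm{corank}(\alpha)$ is $n$ minus the number of blocks of the form $\{a,b'\}$, $a,b\in M$; it is even. Green's relation: $\alpha\mathcal{R}\beta$ iff $\alpha,\beta$ contain the same two-element subsets of $M$. An $\mathcal{R}$-cross-section is a subsemigroup containing exactly one element of each $\mathcal{R}$-class. An $\mathcal{R}$-cross-section $\Lambda$ is canonical if every $\alpha\in\Lambda$ of corank $2k$ satisfies $(n-2k+1)'\equiv_\alpha(n-2k+2)'$, $(n-2k+3)'\equiv_\alpha(n-2k+4)'$, ..., $(n-1)'\equiv_\alpha n'$. For a canonical $\Lambda$ and $1\le i<j\le n$, $\alpha_{i,j}$ denotes the unique element of $\Lambda$ of corank $2$ with $i\equiv_{\alpha_{i,j}}j$. For $1\le i<j<n-1$ and $l=1,\dots,\lfloor\frac{n-j}{2}\rfloor$,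 define $\alpha_{i,j}^{(l)}\in\mathcal{S}_2$ to be $\mathrm{id}$ if $(n-2l+2)\equiv_{\alpha_{i,j}}(n-2l)'$ and $(1,2)$ if $(n-2l+2)\equiv_{\alpha_{i,j}}(n-2l-1)'$ (exactly one of the two always holds). $\mathfrak{A}_n$ is the set of all pairs $(n-3,n-2),(n-5,n-4),\dots$ with positive entries. A canonical $\mathcal{R}$-cross-section is regular if $\alpha_{i,j}^{(l)}=\mathrm{id}$ for all admissible $i,j,l$; it is alternating if $\alpha_{i,j}^{(l)}=(1,2)$ for all admissible $(i,j)\notin\mathfrak{A}_n$ and all admissible $l$, and $\alpha_{i,i+1}^{(l)}=\mathrm{id}$ for all $(i,i+1)\in\mathfrak{A}_n$ and all admissible $l$. (For $n\ge 6$ both exist and each is uniquely determined by these conditions.) *)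

theory Defs
  imports "HOL-Library.Disjoint_Sets" "HOL-Algebra.Group" "HOL-Combinatorics.Transposition"
begin

text \<open>\<open>Lft a\<close> is the left pin \<open>a\<close> and \<open>Rgt a\<close> is the right pin \<open>a'\<close>.\<close>

datatype pin = Lft nat | Rgt nat

definition pins :: "nat \<Rightarrow> pin set" where
  "pins n = Lft ` {1..n} \<union> Rgt ` {1..n}"

definition brauer :: "nat \<Rightarrow> pin set set set" where
  "brauer n = {\<alpha>. partition_on (pins n) \<alpha> \<and> (\<forall>B\<in>\<alpha>. card B = 2)}"

definition joined :: "pin set set \<Rightarrow> pin \<Rightarrow> pin \<Rightarrow> bool" where
  "joined \<alpha> x y \<longleftrightarrow> {x, y} \<in> \<alpha>"

text \<open>Vertices of the diagram with \<open>\<alpha>\<close> drawn to the left of \<open>\<beta>\<close>: the right pins of \<open>\<alpha>\<close> and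
  the left pins of \<open>\<beta>\<close> are identified in the middle column.\<close>

datatype vertex = West nat | Mid nat | East nat

fun in_left :: "pin \<Rightarrow> vertex" where
  "in_left (Lft a) = West a"
| "in_left (Rgt a) = Mid a"

fun in_right :: "pin \<Rightarrow> vertex" where
  "in_right (Lft a) = Mid a"
| "in_right (Rgt a) = East a"

fun outer :: "pin \<Rightarrow> vertex" where
  "outer (Lft a) = West a"
| "outer (Rgt a) = East a"

definition diagram_edges :: "pin set set \<Rightarrow> pin set set \<Rightarrow> (vertex \<times> vertex) set" where
  "diagram_edges \<alpha> \<beta> =
     {(in_left x, in_left y) | x y. joined \<alpha> x y} \<union>
     {(in_right x, in_right y) | x y. joined \<beta> x y}"

definition brauer_mult :: "pin set set \<Rightarrow> pin set set \<Rightarrow> pin set set" where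
  "brauer_mult \<alpha> \<beta> =
     {{x, y} | x y. x \<noteq> y \<and> (outer x, outer y) \<in> (diagram_edges \<alpha> \<beta>)\<^sup>*}"

definition brauer_one :: "nat \<Rightarrow> pin set set" where
  "brauer_one n = {{Lft a, Rgt a} | a. a \<in> {1..n}}"

text \<open>The monoid structure of the Brauer semigroup restricted to a subset \<open>S\<close>.
  A cross-section contains exactly one permutation, which is idempotent by closure and hence the
  identity. So cross-sections are submonoids, and a multiplicative bijection (\<open>iso\<close>) between
  two of them preserves the unit.\<close>

definition brauer_monoid_on :: "nat \<Rightarrow> pin set set set \<Rightarrow> pin set set monoid" where
  "brauer_monoid_on n S = \<lparr>carrier = S, mult = brauer_mult, one = brauer_one n\<rparr>"

definition corank :: "nat \<Rightarrow> pin set set \<Rightarrow> nat" where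
  "corank n \<alpha> = n - card {B \<in> \<alpha>. \<exists>a\<in>{1..n}. \<exists>b\<in>{1..n}. B = {Lft a, Rgt b}}"

text \<open>Green's relation \<open>R\<close>, described by the blocks within the left pins.\<close>

definition R_rel :: "nat \<Rightarrow> pin set set rel" where
  "R_rel n = {(\<alpha>, \<beta>). \<alpha> \<in> brauer n \<and> \<beta> \<in> brauer n \<and>
     {B \<in> \<alpha>. B \<subseteq> Lft ` {1..n}} = {B \<in> \<beta>. B \<subseteq> Lft ` {1..n}}}"

definition R_cross_section :: "nat \<Rightarrow> pin set set set \<Rightarrow> bool" where
  "R_cross_section n \<Lambda> \<longleftrightarrow>
     \<Lambda> \<subseteq> brauer n \<and>
     (\<forall>\<alpha>\<in>\<Lambda>. \<forall>\<beta>\<in>\<Lambda>. brauer_mult \<alpha> \<beta> \<in> \<Lambda>) \<and>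
     (\<forall>C \<in> brauer n // R_rel n. \<exists>!\<alpha>. \<alpha> \<in> \<Lambda> \<and> \<alpha> \<in> C)"

definition canonical :: "nat \<Rightarrow> pin set set set \<Rightarrow> bool" where
  "canonical n \<Lambda> \<longleftrightarrow>
     R_cross_section n \<Lambda> \<and>
     (\<forall>\<alpha>\<in>\<Lambda>. \<forall>k. corank n \<alpha> = 2 * k \<longrightarrow>
        (\<forall>m\<in>{1..k}. joined \<alpha> (Rgt (n - 2 * m + 1)) (Rgt (n - 2 * m + 2))))"

text \<open>The element \<open>\<alpha>\<^sub>i\<^sub>,\<^sub>j\<close> of a canonical cross-section, for \<open>1 \<le> i < j \<le> n\<close>.\<close>

definition elem2 :: "nat \<Rightarrow> pin set set set \<Rightarrow> nat \<Rightarrow> nat \<Rightarrow> pin set set" where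
  "elem2 n \<Lambda> i j = (THE \<alpha>. \<alpha> \<in> \<Lambda> \<and> corank n \<alpha> = 2 \<and> joined \<alpha> (Lft i) (Lft j))"

text \<open>The value of \<open>twist n \<Lambda> i j l\<close> is the element \<open>id\<close> or \<open>(1,2)\<close> of the symmetric group
  on \<open>{1, 2}\<close> attached to \<open>elem2 n \<Lambda> i j\<close>. For canonical \<open>\<Lambda>\<close> and \<open>admissible n i j l\<close>, exactly
  one of the two conditions holds; the default value \<open>\<lambda>_. 0\<close> is deliberately not a permutation.\<close>

definition twist :: "nat \<Rightarrow> pin set set set \<Rightarrow> nat \<Rightarrow> nat \<Rightarrow> nat \<Rightarrow> (nat \<Rightarrow> nat)" where
  "twist n \<Lambda> i j l =
     (if joined (elem2 n \<Lambda> i j) (Lft (n - 2 * l + 2)) (Rgt (n - 2 * l)) then id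
      else if joined (elem2 n \<Lambda> i j) (Lft (n - 2 * l + 2)) (Rgt (n - 2 * l - 1))
        then transpose 1 2
      else (\<lambda>_. 0))"

definition admissible :: "nat \<Rightarrow> nat \<Rightarrow> nat \<Rightarrow> nat \<Rightarrow> bool" where
  "admissible n i j l \<longleftrightarrow> 1 \<le> i \<and> i < j \<and> j < n - 1 \<and> 1 \<le> l \<and> l \<le> (n - j) div 2"

definition exceptional_pairs :: "nat \<Rightarrow> (nat \<times> nat) set" where
  "exceptional_pairs n = {(n - 2 * m - 1, n - 2 * m) | m. 1 \<le> m \<and> 2 * m + 1 < n}"

definition regular :: "nat \<Rightarrow> pin set set set \<Rightarrow> bool" where
  "regular n \<Lambda> \<longleftrightarrow>
     canonical n \<Lambda> \<and> (\<forall>i j l. admissible n i j l \<longrightarrow> twist n \<Lambda> i j l = id)"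

definition alternating :: "nat \<Rightarrow> pin set set set \<Rightarrow> bool" where
  "alternating n \<Gamma> \<longleftrightarrow>
     canonical n \<Gamma> \<and>
     (\<forall>i j l. admissible n i j l \<longrightarrow>
        twist n \<Gamma> i j l = (if (i, j) \<in> exceptional_pairs n then id else transpose 1 2))"

end

theory Submission
  imports Defs
begin

text \<open>Write \<open>a\<^sub>e\<close> for the bijection from the left pins off the arc \<open>e = {i, j}\<close> to the right pins
  \<open>{1..n - 2}\<close> given by \<open>\<alpha>\<^sub>i\<^sub>,\<^sub>j\<close>. If \<open>e\<close> and \<open>f\<close> are disjoint arcs, then \<open>\<alpha>\<^sub>e \<alpha>\<^sub>p = \<alpha>\<^sub>f \<alpha>\<^sub>q\<close> with
  \<open>p = a\<^sub>e f\<close> and \<open>q = a\<^sub>f e\<close>, so the monoid sees how \<open>a\<^sub>e\<close> acts on arcs. When \<open>e\<close> lies in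
  \<open>{1..n - 2}\<close>, \<open>a\<^sub>e\<close> sends \<open>{n - 1, n}\<close> to \<open>{n - 3, n - 2}\<close>, and the twist tells in which order. In
  the regular case the order is the same for all such \<open>e\<close>. In the alternating case it differs for
  \<open>e = {n - 3, n - 2}\<close> and \<open>f = {1, n - 2}\<close>, so that \<open>a\<^sub>e {2, n} = a\<^sub>f {2, n - 1} = {2, n - 2}\<close>. The
  invariant is the existence of such a coincidence, stated in terms of multiplication alone.\<close>

section \<open>Pairings and their products\<close>

lemma joined_sym: "joined \<alpha> x y \<Longrightarrow> joined \<alpha> y x"
  by (simp add: joined_def insert_commute)

lemma joined_neq: "\<alpha> \<in> brauer n \<Longrightarrow> joined \<alpha> x y \<Longrightarrow> x \<noteq> y"
  by (auto simp: joined_def brauer_def)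

lemma joined_pins: "\<alpha> \<in> brauer n \<Longrightarrow> joined \<alpha> x y \<Longrightarrow> x \<in> pins n \<and> y \<in> pins n"
  by (auto simp: joined_def brauer_def partition_on_def)

lemma joined_unique:
  assumes "\<alpha> \<in> brauer n" "joined \<alpha> x y" "joined \<alpha> x z"
  shows "y = z"
proof -
  have "disjoint \<alpha>" "{x, y} \<in> \<alpha>" "{x, z} \<in> \<alpha>"
    using assms by (auto simp: joined_def brauer_def partition_on_def)
  then have "{x, y} = {x, z}" by (metis disjointD disjoint_iff insertI1)
  then show ?thesis by (metis doubleton_eq_iff)
qed

lemma joined_unique_left: "\<alpha> \<in> brauer n \<Longrightarrow> joined \<alpha> x z \<Longrightarrow> joined \<alpha> y z \<Longrightarrow> x = y"
  using joined_unique[OF _ joined_sym joined_sym] by blast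

lemma joined_total:
  assumes "\<alpha> \<in> brauer n" "x \<in> pins n"
  obtains y where "joined \<alpha> x y"
proof -
  obtain B where B: "B \<in> \<alpha>" "x \<in> B" "card B = 2"
    using assms by (auto simp: brauer_def partition_on_def)
  then obtain a b where "B = {a, b}" by (auto simp: card_2_iff)
  with B have "joined \<alpha> x a \<or> joined \<alpha> x b"
    by (auto simp: joined_def insert_commute)
  then show thesis using that by blast
qed

lemma joined_index:
  assumes "\<alpha> \<in> brauer n"
  shows "joined \<alpha> (Lft a) y \<Longrightarrow> a \<in> {1..n}" "joined \<alpha> (Rgt a) y \<Longrightarrow> a \<in> {1..n}"
    "joined \<alpha> y (Lft a) \<Longrightarrow> a \<in> {1..n}" "joined \<alpha> y (Rgt a) \<Longrightarrow> a \<in> {1..n}"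
  using joined_pins[OF assms] by (fastforce simp: pins_def)+

lemma joined_Lft_cases:
  assumes "\<alpha> \<in> brauer n" "a \<in> {1..n}"
  obtains b where "joined \<alpha> (Lft a) (Lft b)" | b where "joined \<alpha> (Lft a) (Rgt b)"
  using joined_total[OF assms(1), of "Lft a"] assms(2) by (metis UnI1 imageI pin.exhaust pins_def)

lemma joined_Rgt_cases:
  assumes "\<alpha> \<in> brauer n" "a \<in> {1..n}"
  obtains b where "joined \<alpha> (Rgt a) (Lft b)" | b where "joined \<alpha> (Rgt a) (Rgt b)"
  using joined_total[OF assms(1), of "Rgt a"] assms(2) by (metis UnI2 imageI pin.exhaust pins_def)

text \<open>Products are computed by exhibiting paths. The product of two elements of a
  cross-section is again in \<open>brauer n\<close>, where each pin has one partner, so a single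
  path settles which partner that is.\<close>

lemma brauer_multI:
  "x \<noteq> y \<Longrightarrow> (outer x, outer y) \<in> (diagram_edges \<alpha> \<beta>)\<^sup>* \<Longrightarrow> joined (brauer_mult \<alpha> \<beta>) x y"
  by (auto simp: joined_def brauer_mult_def)

lemma left_edge: "joined \<alpha> x y \<Longrightarrow> (in_left x, in_left y) \<in> diagram_edges \<alpha> \<beta>"
  by (auto simp: diagram_edges_def)

lemma right_edge: "joined \<beta> x y \<Longrightarrow> (in_right x, in_right y) \<in> diagram_edges \<alpha> \<beta>"
  by (auto simp: diagram_edges_def)

lemma mult_LL:
  assumes "\<alpha> \<in> brauer n" "joined \<alpha> (Lft a) (Lft b)"
  shows "joined (brauer_mult \<alpha> \<beta>) (Lft a) (Lft b)"
  using joined_neq[OF assms] left_edge[OF assms(2), of \<beta>] by (intro brauer_multI) auto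

lemma mult_LR:
  assumes "joined \<alpha> (Lft a) (Rgt b)" "joined \<beta> (Lft b) (Rgt c)"
  shows "joined (brauer_mult \<alpha> \<beta>) (Lft a) (Rgt c)"
  using left_edge[OF assms(1), of \<beta>] right_edge[OF assms(2), of \<alpha>]
  by (intro brauer_multI) (auto intro: rtrancl_trans)

lemma mult_pullback:
  assumes "joined \<alpha> (Lft a) (Rgt p)" "joined \<beta> (Lft p) (Lft q)" "joined \<alpha> (Lft b) (Rgt q)" "a \<noteq> b"
  shows "joined (brauer_mult \<alpha> \<beta>) (Lft a) (Lft b)"
  using left_edge[OF assms(1), of \<beta>] right_edge[OF assms(2), of \<alpha>]
    left_edge[OF joined_sym[OF assms(3)], of \<beta>] assms(4)
  by (intro brauer_multI) (auto intro: rtrancl_trans)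

lemma mult_push:
  assumes "joined \<beta> (Lft u) (Rgt c)" "joined \<alpha> (Rgt u) (Rgt v)" "joined \<beta> (Lft v) (Rgt d)" "c \<noteq> d"
  shows "joined (brauer_mult \<alpha> \<beta>) (Rgt c) (Rgt d)"
  using right_edge[OF joined_sym[OF assms(1)], of \<alpha>] left_edge[OF assms(2), of \<beta>]
    right_edge[OF assms(3), of \<alpha>] assms(4)
  by (intro brauer_multI) (auto intro: rtrancl_trans)

text \<open>The path turns twice in the middle column, along a left arc of \<open>\<beta>\<close>
  and then a right arc of \<open>\<alpha>\<close>. It stops at \<open>Mid r\<close>, from where it
  may leave on either side.\<close>

lemma mult_zigzag:
  assumes "joined \<alpha> (Lft a) (Rgt p)" "joined \<beta> (Lft p) (Lft q)" "joined \<alpha> (Rgt q) (Rgt r)"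
  shows "(West a, Mid r) \<in> (diagram_edges \<alpha> \<beta>)\<^sup>*"
  using left_edge[OF assms(1), of \<beta>] right_edge[OF assms(2), of \<alpha>]
    left_edge[OF assms(3), of \<beta>]
  by (auto intro: rtrancl_trans)

lemma mult_LR_zigzag:
  assumes "joined \<alpha> (Lft a) (Rgt p)" "joined \<beta> (Lft p) (Lft q)" "joined \<alpha> (Rgt q) (Rgt r)"
    "joined \<beta> (Lft r) (Rgt c)"
  shows "joined (brauer_mult \<alpha> \<beta>) (Lft a) (Rgt c)"
  using mult_zigzag[OF assms(1-3)] right_edge[OF assms(4), of \<alpha>]
  by (intro brauer_multI) (auto intro: rtrancl_trans)

lemma mult_LL_zigzag:
  assumes "joined \<alpha> (Lft a) (Rgt p)" "joined \<beta> (Lft p) (Lft q)" "joined \<alpha> (Rgt q) (Rgt r)"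
    "joined \<beta> (Lft r) (Lft s)" "joined \<alpha> (Lft b) (Rgt s)" "a \<noteq> b"
  shows "joined (brauer_mult \<alpha> \<beta>) (Lft a) (Lft b)"
  using mult_zigzag[OF assms(1-3)] right_edge[OF assms(4), of \<alpha>]
    left_edge[OF joined_sym[OF assms(5)], of \<beta>] assms(6)
  by (intro brauer_multI) (auto intro: rtrancl_trans)

section \<open>Corank\<close>

definition left_arcs :: "nat \<Rightarrow> pin set set \<Rightarrow> pin set set" where
  "left_arcs n \<alpha> = {B \<in> \<alpha>. B \<subseteq> Lft ` {1..n}}"

lemma left_arcs_iff:
  assumes "\<alpha> \<in> brauer n"
  shows "B \<in> left_arcs n \<alpha> \<longleftrightarrow> (\<exists>u v. B = {Lft u, Lft v} \<and> joined \<alpha> (Lft u) (Lft v))"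
proof
  assume B: "B \<in> left_arcs n \<alpha>"
  then have "card B = 2" using assms by (auto simp: left_arcs_def brauer_def)
  then obtain x y where "B = {x, y}" by (auto simp: card_2_iff)
  with B show "\<exists>u v. B = {Lft u, Lft v} \<and> joined \<alpha> (Lft u) (Lft v)"
    by (auto simp: left_arcs_def joined_def)
next
  assume "\<exists>u v. B = {Lft u, Lft v} \<and> joined \<alpha> (Lft u) (Lft v)"
  then obtain u v where uv: "B = {Lft u, Lft v}" "joined \<alpha> (Lft u) (Lft v)" by blast
  with joined_index[OF assms] have "u \<in> {1..n}" "v \<in> {1..n}" by blast+
  with uv show "B \<in> left_arcs n \<alpha>" by (auto simp: left_arcs_def joined_def)
qed

lemma finite_brauer: "\<alpha> \<in> brauer n \<Longrightarrow> finite \<alpha>"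
  by (auto simp: brauer_def pins_def intro: finite_elements[rotated])


text \<open>Either end determines a transversal block, so all three counts equal the size of the set
  \<open>P\<close> of index pairs.\<close>

lemma card_transversals:
  assumes "\<alpha> \<in> brauer n"
  shows "card {B \<in> \<alpha>. \<exists>a\<in>{1..n}. \<exists>b\<in>{1..n}. B = {Lft a, Rgt b}}
      = card {a. \<exists>b. joined \<alpha> (Lft a) (Rgt b)}" (is "card ?X = card ?A")
    and "card {a. \<exists>b. joined \<alpha> (Lft a) (Rgt b)} = card {b. \<exists>a. joined \<alpha> (Lft a) (Rgt b)}"
      (is "_ = card ?B")
proof -
  define P where "P = {(a, b). joined \<alpha> (Lft a) (Rgt b)}"
  have X: "?X = (\<lambda>(a, b). {Lft a, Rgt b}) ` P"
  proof
    show "?X \<subseteq> (\<lambda>(a, b). {Lft a, Rgt b}) ` P" by (auto simp: P_def joined_def)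
    show "(\<lambda>(a, b). {Lft a, Rgt b}) ` P \<subseteq> ?X"
    proof
      fix B assume "B \<in> (\<lambda>(a, b). {Lft a, Rgt b}) ` P"
      then obtain a b where ab: "B = {Lft a, Rgt b}" "joined \<alpha> (Lft a) (Rgt b)"
        by (auto simp: P_def)
      with joined_index[OF assms] have "a \<in> {1..n}" "b \<in> {1..n}" by blast+
      with ab show "B \<in> ?X" unfolding joined_def by blast
    qed
  qed
  have "inj_on (\<lambda>(a, b). {Lft a, Rgt b}) P"
    by (auto simp: inj_on_def doubleton_eq_iff)
  then have 1: "card ?X = card P" unfolding X by (rule card_image)
  have "inj_on fst P"
    using joined_unique[OF assms] by (fastforce simp: inj_on_def P_def)
  moreover have "inj_on snd P"
    using joined_unique[OF assms joined_sym joined_sym] by (fastforce simp: inj_on_def P_def)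
  ultimately have 2: "card (fst ` P) = card P" "card (snd ` P) = card P" by (simp_all add: card_image)
  have "fst ` P = ?A" "snd ` P = ?B" by (force simp: P_def)+
  with 1 2 show "card ?X = card ?A" "card ?A = card ?B" by auto
qed

lemma corank_left:
  assumes "\<alpha> \<in> brauer n"
  shows "corank n \<alpha> = card {a. \<exists>b. joined \<alpha> (Lft a) (Lft b)}" (is "_ = card ?L")
proof -
  let ?A = "{a. \<exists>b. joined \<alpha> (Lft a) (Rgt b)}"
  have "?L \<union> ?A = {1..n}"
    using joined_index[OF assms] joined_Lft_cases[OF assms] by blast
  moreover have "?L \<inter> ?A = {}" using joined_unique[OF assms] by fastforce
  ultimately have "card ?L + card ?A = n"
    by (metis card_Un_disjoint card_atLeastAtMost diff_Suc_1 finite_Un finite_atLeastAtMost)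
  then show ?thesis unfolding corank_def card_transversals(1)[OF assms] by linarith
qed

text \<open>Transversals have as many right ends as left ends, so the pins left over for arcs are
  equally many on both sides.\<close>

lemma corank_right:
  assumes "\<alpha> \<in> brauer n"
  shows "corank n \<alpha> = card {a. \<exists>b. joined \<alpha> (Rgt a) (Rgt b)}" (is "_ = card ?L")
proof -
  let ?A = "{b. \<exists>a. joined \<alpha> (Lft a) (Rgt b)}"
  have "?L \<union> ?A = {1..n}"
  proof
    show "?L \<union> ?A \<subseteq> {1..n}" using joined_index[OF assms] by blast
    show "{1..n} \<subseteq> ?L \<union> ?A"
    proof
      fix a assume "a \<in> {1..n}"
      from assms this show "a \<in> ?L \<union> ?A" by (rule joined_Rgt_cases) (auto dest: joined_sym)
    qed
  qed
  moreover have "?L \<inter> ?A = {}" using joined_unique[OF assms _ joined_sym] by fastforce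
  ultimately have "card ?L + card ?A = n"
    by (metis card_Un_disjoint card_atLeastAtMost diff_Suc_1 finite_Un finite_atLeastAtMost)
  then show ?thesis unfolding corank_def card_transversals[OF assms] by linarith
qed

lemma corank_arcs:
  assumes "\<alpha> \<in> brauer n"
  shows "corank n \<alpha> = 2 * card (left_arcs n \<alpha>)"
proof -
  let ?L = "{a. \<exists>b. joined \<alpha> (Lft a) (Lft b)}"
  have 1: "Lft ` ?L = \<Union>(left_arcs n \<alpha>)"
  proof
    show "Lft ` ?L \<subseteq> \<Union>(left_arcs n \<alpha>)"
    proof
      fix x assume "x \<in> Lft ` ?L"
      then obtain a b where "x = Lft a" "joined \<alpha> (Lft a) (Lft b)" by auto
      then have "x \<in> {Lft a, Lft b}" "{Lft a, Lft b} \<in> left_arcs n \<alpha>"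
        using left_arcs_iff[OF assms] by blast+
      then show "x \<in> \<Union>(left_arcs n \<alpha>)" by blast
    qed
    show "\<Union>(left_arcs n \<alpha>) \<subseteq> Lft ` ?L"
    proof
      fix x assume "x \<in> \<Union>(left_arcs n \<alpha>)"
      then obtain u v where "x \<in> {Lft u, Lft v}" "joined \<alpha> (Lft u) (Lft v)"
        using left_arcs_iff[OF assms] by blast
      then show "x \<in> Lft ` ?L" using joined_sym[of \<alpha> "Lft u" "Lft v"] by blast
    qed
  qed
  have "card (\<Union>(left_arcs n \<alpha>)) = sum card (left_arcs n \<alpha>)"
  proof (rule card_Union_disjoint)
    show "pairwise disjnt (left_arcs n \<alpha>)"
      using assms by (simp add: left_arcs_def brauer_def partition_on_def disjoint_def pairwise_def
          disjnt_def)
    show "finite B" if "B \<in> left_arcs n \<alpha>" for B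
      using that by (auto simp: left_arcs_def intro: finite_subset)
  qed
  also have "\<dots> = sum (\<lambda>_. 2) (left_arcs n \<alpha>)"
    using assms by (intro sum.cong) (auto simp: left_arcs_def brauer_def)
  finally have "card (Lft ` ?L) = 2 * card (left_arcs n \<alpha>)" by (simp add: 1)
  moreover have "card (Lft ` ?L) = card ?L" by (intro card_image) (simp add: inj_on_def)
  ultimately show ?thesis by (simp add: corank_left[OF assms])
qed

lemma corank_ge_2:
  assumes "\<alpha> \<in> brauer n" "joined \<alpha> (Lft i) (Lft j)"
  shows "corank n \<alpha> \<ge> 2"
proof -
  have "{Lft i, Lft j} \<in> left_arcs n \<alpha>" using assms left_arcs_iff by blast
  moreover have "finite (left_arcs n \<alpha>)" using finite_brauer[OF assms(1)] by (simp add: left_arcs_def)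
  ultimately have "card (left_arcs n \<alpha>) > 0" by (auto simp: card_gt_0_iff)
  then show ?thesis by (simp add: corank_arcs[OF assms(1)])
qed

lemma corank_ge_4:
  assumes "\<alpha> \<in> brauer n" "joined \<alpha> (Lft i) (Lft j)" "joined \<alpha> (Lft k) (Lft l)" "{i, j} \<noteq> {k, l}"
  shows "corank n \<alpha> \<ge> 4"
proof -
  have "{Lft i, Lft j} \<noteq> {Lft k, Lft l}" using assms(4) by (auto simp: doubleton_eq_iff)
  moreover have "{{Lft i, Lft j}, {Lft k, Lft l}} \<subseteq> left_arcs n \<alpha>"
    using assms left_arcs_iff by blast
  moreover have "finite (left_arcs n \<alpha>)" using finite_brauer[OF assms(1)] by (simp add: left_arcs_def)
  ultimately have "card (left_arcs n \<alpha>) \<ge> 2" by (metis card_2_iff card_mono)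
  then show ?thesis by (simp add: corank_arcs[OF assms(1)])
qed

text \<open>The witness repeats the arc on the right and is horizontal elsewhere. It provides the
  R-class in which a cross-section must have a representative.\<close>

lemma one_arc_exists:
  assumes "i \<in> {1..n}" "j \<in> {1..n}" "i \<noteq> j"
  obtains \<alpha> where "\<alpha> \<in> brauer n" "left_arcs n \<alpha> = {{Lft i, Lft j}}"
proof -
  define \<alpha> where "\<alpha> = insert {Lft i, Lft j} (insert {Rgt i, Rgt j}
    ((\<lambda>a. {Lft a, Rgt a}) ` ({1..n} - {i, j})))"
  have "\<Union>\<alpha> = pins n" using assms by (auto simp: \<alpha>_def pins_def)
  moreover have "disjoint \<alpha>" using assms by (auto simp: \<alpha>_def disjoint_def)
  moreover have "\<forall>B\<in>\<alpha>. card B = 2" using assms by (auto simp: \<alpha>_def)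
  ultimately have "\<alpha> \<in> brauer n" by (fastforce simp: brauer_def partition_on_def)
  moreover have "left_arcs n \<alpha> = {{Lft i, Lft j}}"
    using assms by (auto simp: left_arcs_def \<alpha>_def)
  ultimately show thesis using that by blast
qed

section \<open>Canonical cross-sections\<close>

locale canonical_section =
  fixes n :: nat and \<Lambda> :: "pin set set set"
  assumes n6: "n \<ge> 6" and can: "canonical n \<Lambda>"
begin

lemma in_brauer: "x \<in> \<Lambda> \<Longrightarrow> x \<in> brauer n"
  using can by (auto simp: canonical_def R_cross_section_def)

lemma mult_closed: "x \<in> \<Lambda> \<Longrightarrow> y \<in> \<Lambda> \<Longrightarrow> brauer_mult x y \<in> \<Lambda>"
  using can by (auto simp: canonical_def R_cross_section_def)

lemma class_representative: "C \<in> brauer n // R_rel n \<Longrightarrow> \<exists>!x. x \<in> \<Lambda> \<and> x \<in> C"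
  using can by (simp add: canonical_def R_cross_section_def)

lemma arcs_exist:
  assumes "\<beta> \<in> brauer n"
  obtains x where "x \<in> \<Lambda>" "left_arcs n x = left_arcs n \<beta>"
proof -
  have "R_rel n `` {\<beta>} \<in> brauer n // R_rel n" using assms by (rule quotientI)
  then have "\<exists>x. x \<in> \<Lambda> \<and> x \<in> R_rel n `` {\<beta>}" by (rule ex1_implies_ex[OF class_representative])
  then show thesis using that by (auto simp: R_rel_def left_arcs_def)
qed

text \<open>Equal left arcs mean the same R-class, which meets \<open>\<Lambda>\<close> only once.
  Equations between products are proved by comparing left arcs in this way.\<close>

lemma arcs_determine:
  assumes "x \<in> \<Lambda>" "y \<in> \<Lambda>" "left_arcs n x = left_arcs n y"
  shows "x = y"
proof -
  have "R_rel n `` {x} \<in> brauer n // R_rel n" using in_brauer[OF assms(1)] by (rule quotientI)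
  then have "\<exists>!z. z \<in> \<Lambda> \<and> z \<in> R_rel n `` {x}" by (rule class_representative)
  moreover have "x \<in> R_rel n `` {x}" "y \<in> R_rel n `` {x}"
    using assms in_brauer by (auto simp: R_rel_def left_arcs_def)
  ultimately show ?thesis using assms by blast
qed

text \<open>Every left pin lies on exactly one block, so the hypotheses need no converses.\<close>

lemma eqI:
  assumes "x \<in> \<Lambda>" "y \<in> \<Lambda>"
    and LL: "\<And>u v. joined x (Lft u) (Lft v) \<Longrightarrow> joined y (Lft u) (Lft v)"
    and LR: "\<And>u v. joined x (Lft u) (Rgt v) \<Longrightarrow> \<exists>w. joined y (Lft u) (Rgt w)"
  shows "x = y"
proof (rule arcs_determine[OF assms(1,2)])
  have x: "x \<in> brauer n" and y: "y \<in> brauer n" using assms in_brauer by auto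
  have "joined x (Lft u) (Lft v)" if yuv: "joined y (Lft u) (Lft v)" for u v
  proof -
    have "u \<in> {1..n}" using joined_index[OF y] yuv by blast
    from x this show ?thesis
    proof (cases rule: joined_Lft_cases)
      case (1 b)
      then show ?thesis using LL[OF 1] joined_unique[OF y yuv] by auto
    next
      case (2 b)
      then show ?thesis using LR[OF 2] joined_unique[OF y yuv] by auto
    qed
  qed
  with LL have "joined x (Lft u) (Lft v) \<longleftrightarrow> joined y (Lft u) (Lft v)" for u v by blast
  then have "B \<in> left_arcs n x \<longleftrightarrow> B \<in> left_arcs n y" for B
    by (simp add: left_arcs_iff[OF x] left_arcs_iff[OF y])
  then show "left_arcs n x = left_arcs n y" by blast
qed

section \<open>Elements with a single left arc, and right arcs in canonical form\<close>

text \<open>A relational form of \<open>elem2\<close> that is symmetric in \<open>i\<close> and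
  \<open>j\<close> and free of definite descriptions; \<open>elem2_eq\<close> links the two.\<close>

definition one_arc :: "pin set set \<Rightarrow> nat \<Rightarrow> nat \<Rightarrow> bool" where
  "one_arc x i j \<longleftrightarrow> x \<in> \<Lambda> \<and> left_arcs n x = {{Lft i, Lft j}}"

lemma one_arcD:
  assumes "one_arc x i j"
  shows "x \<in> \<Lambda>" "x \<in> brauer n" "joined x (Lft i) (Lft j)" "i \<in> {1..n}" "j \<in> {1..n}" "i \<noteq> j"
    "corank n x = 2"
proof -
  show 1: "x \<in> \<Lambda>" using assms by (simp add: one_arc_def)
  show 2: "x \<in> brauer n" by (rule in_brauer[OF 1])
  have 3: "left_arcs n x = {{Lft i, Lft j}}" using assms by (simp add: one_arc_def)
  then show 4: "joined x (Lft i) (Lft j)" by (auto simp: left_arcs_def joined_def)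
  then show "i \<in> {1..n}" "j \<in> {1..n}" "i \<noteq> j"
    using joined_index[OF 2] joined_neq[OF 2 4] by blast+
  show "corank n x = 2" using corank_arcs[OF 2] by (simp add: 3)
qed

lemma one_arc_sym: "one_arc x i j \<Longrightarrow> one_arc x j i"
  by (simp add: one_arc_def insert_commute)

lemma one_arc_unique:
  assumes "one_arc x i j" "joined x (Lft u) (Lft v)"
  shows "{u, v} = {i, j}"
proof -
  have "{Lft u, Lft v} \<in> left_arcs n x"
    using assms(2) left_arcs_iff[OF one_arcD(2)[OF assms(1)]] by blast
  then show ?thesis using assms by (auto simp: one_arc_def doubleton_eq_iff)
qed

lemma one_arcI:
  assumes "x \<in> \<Lambda>" "joined x (Lft i) (Lft j)"
    and "\<And>u v. joined x (Lft u) (Lft v) \<Longrightarrow> {u, v} = {i, j}"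
  shows "one_arc x i j"
proof -
  have "left_arcs n x = {{Lft i, Lft j}}"
  proof
    show "left_arcs n x \<subseteq> {{Lft i, Lft j}}"
      using assms(3) by (fastforce simp: left_arcs_iff[OF in_brauer[OF assms(1)]] doubleton_eq_iff)
    show "{{Lft i, Lft j}} \<subseteq> left_arcs n x"
      using assms(2) left_arcs_iff[OF in_brauer[OF assms(1)]] by blast
  qed
  with assms(1) show ?thesis by (simp add: one_arc_def)
qed

lemma one_arc_eq: "one_arc x i j \<Longrightarrow> one_arc y i j \<Longrightarrow> x = y"
  unfolding one_arc_def by (metis arcs_determine)

lemma one_arc_ex:
  assumes "i \<in> {1..n}" "j \<in> {1..n}" "i \<noteq> j"
  obtains x where "one_arc x i j"
  using one_arc_exists[OF assms] arcs_exist by (metis one_arc_def)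

lemma one_arc_off:
  assumes "one_arc x i j" "u \<in> {1..n}" "u \<notin> {i, j}"
  obtains v where "joined x (Lft u) (Rgt v)"
  using joined_Lft_cases[OF one_arcD(2)[OF assms(1)] assms(2)] one_arc_unique[OF assms(1)] assms(3)
  by (metis insertI1)

text \<open>In the canonical form the right arcs fill the last pins, so corank determines which right
  pins lie on an arc.\<close>

lemma right_arcs:
  assumes "x \<in> \<Lambda>" "corank n x = 2 * k"
  shows "(\<exists>c. joined x (Rgt b) (Rgt c)) \<longleftrightarrow> n - 2 * k < b \<and> b \<le> n"
proof -
  let ?R = "{a. \<exists>b. joined x (Rgt a) (Rgt b)}"
  have x: "x \<in> brauer n" by (rule in_brauer[OF assms(1)])
  have k: "2 * k \<le> n" using assms(2) by (simp add: corank_def)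
  have arcs: "joined x (Rgt (n - 2 * m + 1)) (Rgt (n - 2 * m + 2))" if "m \<in> {1..k}" for m
    using can assms that by (auto simp: canonical_def)
  have "{n - 2 * k <.. n} \<subseteq> ?R"
  proof
    fix b assume "b \<in> {n - 2 * k <.. n}"
    \<comment> \<open>The pins of the \<open>m\<close>-th arc satisfy
      \<open>n - b + 2 = 2 * m + 1\<close> or \<open>n - b + 2 = 2 * m\<close>, and halving recovers
      \<open>m\<close>.\<close>
    then have "\<exists>m\<in>{1..k}. b = n - 2 * m + 1 \<or> b = n - 2 * m + 2"
      using k by (intro bexI[of _ "(n - b + 2) div 2"]) (auto; presburger)+
    then show "b \<in> ?R" using arcs joined_sym by blast
  qed
  moreover have "card ?R = 2 * k" using corank_right[OF x] assms(2) by simp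
  moreover have "?R \<subseteq> {1..n}" using joined_index[OF x] by blast
  then have "finite ?R" by (rule finite_subset) simp
  \<comment> \<open>The prescribed arcs already cover \<open>2 * k\<close> right pins, which is as
    many as lie on right arcs at all.\<close>
  ultimately have "{n - 2 * k <.. n} = ?R" using k by (intro card_subset_eq) auto
  then show ?thesis by auto
qed

lemma one_arc_right: "one_arc x i j \<Longrightarrow> joined x (Rgt (n - 1)) (Rgt n)"
proof -
  assume x: "one_arc x i j"
  have "\<forall>m\<in>{1..1}. joined x (Rgt (n - 2 * m + 1)) (Rgt (n - 2 * m + 2))"
    using can one_arcD(1,7)[OF x] unfolding canonical_def by (metis mult.right_neutral)
  moreover have "n - 2 * 1 + 1 = n - 1" "n - 2 * 1 + 2 = n" using n6 by auto
  ultimately show ?thesis by force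
qed

lemma right_transversal:
  assumes "x \<in> \<Lambda>" "corank n x = 2 * k" "b \<in> {1..n - 2 * k}"
  obtains a where "joined x (Lft a) (Rgt b)"
proof -
  have "b \<in> {1..n}" using assms(3) by auto
  from in_brauer[OF assms(1)] this show thesis
  proof (cases rule: joined_Rgt_cases)
    case (1 a)
    then show ?thesis using that joined_sym by blast
  next
    case (2 c)
    then have "\<exists>c. joined x (Rgt b) (Rgt c)" by blast
    then show ?thesis using right_arcs[OF assms(1,2)] assms(3) by auto
  qed
qed

section \<open>Absorption, and products of two one-arc elements\<close>

text \<open>Left arcs of \<open>x\<close> survive. A transversal of \<open>x\<close> ending at
  \<open>v\<close> cannot end at \<open>i\<close>. If \<open>v \<noteq> j\<close>, it passes
  straight through \<open>t\<close>; if \<open>v = j\<close>, it turns to \<open>i\<close>, crosses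
  to \<open>i'\<close> and leaves \<open>t\<close> from there. Hence no new left arc
  appears.\<close>

lemma absorb:
  assumes x: "x \<in> \<Lambda>" and ii: "joined x (Rgt i) (Rgt i')" and t: "one_arc t i j"
  shows "brauer_mult x t = x"
proof -
  have bx: "x \<in> brauer n" by (rule in_brauer[OF x])
  \<comment> \<open>The equation is oriented this way because \<open>eqI\<close> asks only about the
    blocks of its left-hand side.\<close>
  have "x = brauer_mult x t"
  proof (rule eqI[OF x mult_closed[OF x one_arcD(1)[OF t]]])
    show "joined (brauer_mult x t) (Lft u) (Lft v)" if "joined x (Lft u) (Lft v)" for u v
      by (rule mult_LL[OF bx that])
    show "\<exists>w. joined (brauer_mult x t) (Lft u) (Rgt w)" if uv: "joined x (Lft u) (Rgt v)" for u v
    proof (cases "v = j")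
      case False
      have "v \<noteq> i" using joined_unique[OF bx ii] joined_sym[OF uv] by blast
      moreover have "v \<in> {1..n}" using joined_index[OF bx] uv by blast
      ultimately obtain w where "joined t (Lft v) (Rgt w)"
        using one_arc_off[OF t] False by blast
      then show ?thesis using mult_LR[OF uv] by blast
    next
      case True
      have "i' \<noteq> j" using joined_unique_left[OF bx uv] ii True by blast
      moreover have "i' \<noteq> i" using joined_neq[OF bx ii] by blast
      moreover have "i' \<in> {1..n}" using joined_index[OF bx] ii by blast
      ultimately obtain w where w: "joined t (Lft i') (Rgt w)"
        using one_arc_off[OF t] by blast
      have "joined t (Lft v) (Lft i)" using one_arcD(3)[OF t] joined_sym True by blast
      then show ?thesis using mult_LR_zigzag[OF uv _ ii w] by blast
    qed
  qed
  then show ?thesis by simp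
qed

text \<open>Absorption reveals transversals of \<open>t\<close>: the block of \<open>x\<close>
  ending at \<open>y\<close> continues through \<open>t\<close> to some \<open>c\<close>, yet the
  product is \<open>x\<close> again, so \<open>c = y\<close>.\<close>

lemma absorb_fixes:
  assumes x: "x \<in> \<Lambda>" "corank n x = 2 * k" and t: "one_arc t i j"
    and i: "n - 2 * k < i" and y: "y \<in> {1..n - 2 * k}" "y \<noteq> j"
  shows "joined t (Lft y) (Rgt y)"
proof -
  have bx: "x \<in> brauer n" by (rule in_brauer[OF x(1)])
  obtain i' where "joined x (Rgt i) (Rgt i')"
    using right_arcs[OF x, of i] i one_arcD[OF t] by auto
  then have xt: "brauer_mult x t = x" using absorb x(1) t by blast
  obtain a where a: "joined x (Lft a) (Rgt y)" using right_transversal[OF x y(1)] .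
  obtain c where c: "joined t (Lft y) (Rgt c)"
  proof (rule one_arc_off[OF t])
    show "y \<in> {1..n}" "y \<notin> {i, j}" using i y by auto
  qed
  have "joined x (Lft a) (Rgt c)" using mult_LR[OF a c] by (simp add: xt)
  then have "c = y" using joined_unique[OF bx a] by auto
  with c show ?thesis by simp
qed

text \<open>The arc of \<open>x\<close> stays and the arc of \<open>t\<close> is pulled back to
  \<open>{a, b}\<close>. Every other left pin runs through both factors to the right side.\<close>

lemma two_arcs:
  assumes x: "one_arc x i j" and t: "one_arc t p q"
    and ap: "joined x (Lft a) (Rgt p)" and bq: "joined x (Lft b) (Rgt q)"
  shows "joined (brauer_mult x t) (Lft u) (Lft v) \<longleftrightarrow> {u, v} = {i, j} \<or> {u, v} = {a, b}"
    "corank n (brauer_mult x t) = 4"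
proof -
  let ?y = "brauer_mult x t"
  note bx = one_arcD(2)[OF x] and bt = one_arcD(2)[OF t]
  have y: "?y \<in> \<Lambda>" using mult_closed one_arcD(1) x t by blast
  note by' = in_brauer[OF y]
  have "a \<noteq> b" using joined_unique[OF bx ap] bq one_arcD(6)[OF t] by auto
  then have ab: "joined ?y (Lft a) (Lft b)"
    using mult_pullback[OF ap one_arcD(3)[OF t] bq] by blast
  have ij: "joined ?y (Lft i) (Lft j)" by (rule mult_LL[OF bx one_arcD(3)[OF x]])
  have only: "{u, v} = {i, j} \<or> {u, v} = {a, b}" if uv: "joined ?y (Lft u) (Lft v)" for u v
  proof -
    have "u \<in> {i, j, a, b}"
    proof (rule ccontr)
      assume u: "u \<notin> {i, j, a, b}"
      have "u \<in> {1..n}" using joined_index[OF by'] uv by blast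
      then obtain w where w: "joined x (Lft u) (Rgt w)" using one_arc_off[OF x] u by blast
      have "w \<noteq> p" "w \<noteq> q"
        using u joined_unique_left[OF bx w] ap bq by blast+
      moreover have "w \<in> {1..n}" using joined_index[OF bx] w by blast
      ultimately obtain c where "joined t (Lft w) (Rgt c)" using one_arc_off[OF t] by blast
      then have "joined ?y (Lft u) (Rgt c)" using mult_LR[OF w] by blast
      then show False using joined_unique[OF by' uv] by auto
    qed
    then consider "u = i" | "u = j" | "u = a" | "u = b" by blast
    then show ?thesis
    proof cases
      case 1 then show ?thesis using joined_unique[OF by' uv] ij by blast
    next
      case 2 then show ?thesis using joined_unique[OF by' uv] joined_sym[OF ij] by blast
    next
      case 3 then show ?thesis using joined_unique[OF by' uv] ab by blast
    next
      case 4 then show ?thesis using joined_unique[OF by' uv] joined_sym[OF ab] by blast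
    qed
  qed
  show "joined ?y (Lft u) (Lft v) \<longleftrightarrow> {u, v} = {i, j} \<or> {u, v} = {a, b}"
    using only ij ab joined_sym[OF ij] joined_sym[OF ab] by (auto simp: doubleton_eq_iff)
  have ne: "{i, j} \<noteq> {a, b}"
    using joined_unique[OF bx ap] one_arcD(3)[OF x] joined_sym[OF one_arcD(3)[OF x]]
    by (metis insertI1 insert_iff pin.distinct(1) singletonD)
  have "left_arcs n ?y = {{Lft i, Lft j}, {Lft a, Lft b}}"
  proof
    show "left_arcs n ?y \<subseteq> {{Lft i, Lft j}, {Lft a, Lft b}}"
      using only by (fastforce simp: left_arcs_iff[OF by'] doubleton_eq_iff)
    show "{{Lft i, Lft j}, {Lft a, Lft b}} \<subseteq> left_arcs n ?y"
      using ij ab left_arcs_iff[OF by'] by blast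
  qed
  moreover have "{Lft i, Lft j} \<noteq> {Lft a, Lft b}" using ne by (auto simp: doubleton_eq_iff)
  ultimately show "corank n ?y = 4" using corank_arcs[OF by'] by simp
qed

end

section \<open>An isomorphism invariant\<close>

text \<open>In a canonical cross-section, \<open>nonunits\<close> are the elements of positive corank, \<open>right_ids\<close>
  the \<open>\<alpha>\<^sub>i\<^sub>,\<^sub>j\<close> with \<open>j > n - 2\<close>, and \<open>tops\<close> the \<open>\<alpha>\<^sub>i\<^sub>,\<^sub>j\<close> with \<open>j \<le> n - 2\<close>.\<close>

definition nonunits :: "('a, 'b) monoid_scheme \<Rightarrow> 'a set" where
  "nonunits G = {x \<in> carrier G. \<exists>t\<in>carrier G. t \<noteq> x \<and> x \<otimes>\<^bsub>G\<^esub> t = x}"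

definition right_ids :: "('a, 'b) monoid_scheme \<Rightarrow> 'a set" where
  "right_ids G = {s \<in> nonunits G. \<forall>x\<in>nonunits G. x \<otimes>\<^bsub>G\<^esub> s = x}"

definition tops :: "('a, 'b) monoid_scheme \<Rightarrow> 'a set" where
  "tops G = {x \<in> nonunits G. x \<notin> right_ids G \<and>
     (\<forall>t\<in>nonunits G. x \<otimes>\<^bsub>G\<^esub> t = x \<longrightarrow> t \<in> right_ids G)}"

text \<open>For \<open>g = \<alpha>\<^sub>v\<^sub>,\<^sub>u\<close> with \<open>u > n - 2\<close>, \<open>\<exists>q. hq = gh\<close> says that \<open>h\<close> is disjoint from \<open>g\<close>, so two
  distinct elements of \<open>right_ids\<close> are inseparable iff they are \<open>\<alpha>\<^sub>v\<^sub>,\<^sub>n\<^sub>-\<^sub>1\<close> and \<open>\<alpha>\<^sub>v\<^sub>,\<^sub>n\<close> for one \<open>v \<le> n - 2\<close>.\<close>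

definition inseparable :: "('a, 'b) monoid_scheme \<Rightarrow> 'a \<Rightarrow> 'a \<Rightarrow> bool" where
  "inseparable G g g' \<longleftrightarrow> (\<forall>h\<in>tops G. (\<exists>q\<in>carrier G. h \<otimes>\<^bsub>G\<^esub> q = g \<otimes>\<^bsub>G\<^esub> h) \<longleftrightarrow>
     (\<exists>q\<in>carrier G. h \<otimes>\<^bsub>G\<^esub> q = g' \<otimes>\<^bsub>G\<^esub> h))"

text \<open>In a canonical cross-section, \<open>e p = g e\<close> says that the bijection
  \<open>a\<^sub>e\<close> carries the arc of \<open>g\<close> onto that of \<open>p\<close>. So
  this is the coincidence \<open>a\<^sub>e {v, n} = a\<^sub>f {v, n - 1}\<close>, up to exchanging
  \<open>n\<close> and \<open>n - 1\<close>.\<close>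

definition crossing :: "('a, 'b) monoid_scheme \<Rightarrow> bool" where
  "crossing G \<longleftrightarrow> (\<exists>e\<in>tops G. \<exists>f\<in>tops G. \<exists>p\<in>tops G. \<exists>g\<in>right_ids G. \<exists>g'\<in>right_ids G.
     g \<noteq> g' \<and> e \<otimes>\<^bsub>G\<^esub> p = g \<otimes>\<^bsub>G\<^esub> e \<and> f \<otimes>\<^bsub>G\<^esub> p = g' \<otimes>\<^bsub>G\<^esub> f \<and> inseparable G g g')"

lemma right_ids_subset: "right_ids G \<subseteq> nonunits G"
  unfolding right_ids_def by (rule Collect_restrict)

lemma tops_subset: "tops G \<subseteq> nonunits G"
  unfolding tops_def by (rule Collect_restrict)

text \<open>Injectivity on a closed carrier lets \<open>\<phi>\<close> preserve and reflect
  equations between products. The bounded quantifiers transfer because \<open>nonunits H\<close> and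
  \<open>carrier H\<close> are images under \<open>\<phi>\<close>.\<close>

lemma crossing_iso:
  assumes "\<phi> \<in> iso G H" and closed: "\<And>x y. x \<in> carrier G \<Longrightarrow> y \<in> carrier G \<Longrightarrow> x \<otimes>\<^bsub>G\<^esub> y \<in> carrier G"
    and H: "crossing H"
  shows "crossing G"
proof -
  have hom: "\<phi> (x \<otimes>\<^bsub>G\<^esub> y) = \<phi> x \<otimes>\<^bsub>H\<^esub> \<phi> y" if "x \<in> carrier G" "y \<in> carrier G" for x y
    using assms(1) that by (simp add: iso_def hom_def)
  have inj: "inj_on \<phi> (carrier G)" and surj: "carrier H = \<phi> ` carrier G"
    using assms(1) by (auto simp: iso_def bij_betw_def)
  have inj_eq: "\<phi> x = \<phi> y \<longleftrightarrow> x = y" if "x \<in> carrier G" "y \<in> carrier G" for x y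
    using inj that by (simp add: inj_on_eq_iff)
  have fixed: "\<phi> x \<otimes>\<^bsub>H\<^esub> \<phi> y = \<phi> x \<longleftrightarrow> x \<otimes>\<^bsub>G\<^esub> y = x"
    if "x \<in> carrier G" "y \<in> carrier G" for x y
    using that by (simp add: hom[symmetric] inj_eq closed)
  have mult_eq: "\<phi> x \<otimes>\<^bsub>H\<^esub> \<phi> y = \<phi> z \<otimes>\<^bsub>H\<^esub> \<phi> w \<longleftrightarrow> x \<otimes>\<^bsub>G\<^esub> y = z \<otimes>\<^bsub>G\<^esub> w"
    if "x \<in> carrier G" "y \<in> carrier G" "z \<in> carrier G" "w \<in> carrier G" for x y z w
    using that by (simp add: hom[symmetric] inj_eq closed)
  have nc: "nonunits G \<subseteq> carrier G" by (auto simp: nonunits_def)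
  have tc: "tops G \<subseteq> carrier G" by (rule subset_trans[OF tops_subset nc])
  have N: "\<phi> x \<in> nonunits H \<longleftrightarrow> x \<in> nonunits G" if "x \<in> carrier G" for x
  proof -
    have "(\<exists>t\<in>carrier G. \<phi> t \<noteq> \<phi> x \<and> \<phi> x \<otimes>\<^bsub>H\<^esub> \<phi> t = \<phi> x)
        \<longleftrightarrow> (\<exists>t\<in>carrier G. t \<noteq> x \<and> x \<otimes>\<^bsub>G\<^esub> t = x)"
      using fixed inj_eq that by blast
    then show ?thesis using that by (simp add: nonunits_def surj)
  qed
  have pull: "\<exists>x\<in>carrier G. y = \<phi> x" if "y \<in> nonunits H" for y
    using that surj by (auto simp: nonunits_def)
  have NH: "nonunits H = \<phi> ` nonunits G"
  proof
    show "nonunits H \<subseteq> \<phi> ` nonunits G" using pull N by blast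
    show "\<phi> ` nonunits G \<subseteq> nonunits H" using nc N by blast
  qed
  have R: "\<phi> x \<in> right_ids H \<longleftrightarrow> x \<in> right_ids G" if x: "x \<in> carrier G" for x
  proof -
    have "(\<forall>y\<in>nonunits G. \<phi> y \<otimes>\<^bsub>H\<^esub> \<phi> x = \<phi> y) \<longleftrightarrow> (\<forall>y\<in>nonunits G. y \<otimes>\<^bsub>G\<^esub> x = y)"
      using fixed x nc by blast
    then show ?thesis using N[OF x] by (simp add: right_ids_def NH)
  qed
  have T: "\<phi> x \<in> tops H \<longleftrightarrow> x \<in> tops G" if x: "x \<in> carrier G" for x
  proof -
    have "(\<forall>t\<in>nonunits G. \<phi> x \<otimes>\<^bsub>H\<^esub> \<phi> t = \<phi> x \<longrightarrow> \<phi> t \<in> right_ids H)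
        \<longleftrightarrow> (\<forall>t\<in>nonunits G. x \<otimes>\<^bsub>G\<^esub> t = x \<longrightarrow> t \<in> right_ids G)"
      using fixed x nc R by blast
    then show ?thesis using N[OF x] R[OF x] by (simp add: tops_def NH)
  qed
  obtain e' f' p' g1' g2' where mem: "e' \<in> tops H" "f' \<in> tops H" "p' \<in> tops H"
      "g1' \<in> right_ids H" "g2' \<in> right_ids H"
    and eqs': "g1' \<noteq> g2'" "e' \<otimes>\<^bsub>H\<^esub> p' = g1' \<otimes>\<^bsub>H\<^esub> e'" "f' \<otimes>\<^bsub>H\<^esub> p' = g2' \<otimes>\<^bsub>H\<^esub> f'"
    and all': "inseparable H g1' g2'"
    using H unfolding crossing_def by blast
  note mem(1-3)[THEN subsetD[OF tops_subset], THEN pull]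
    mem(4-5)[THEN subsetD[OF right_ids_subset], THEN pull]
  then obtain e f p g1 g2 where
    eq: "e' = \<phi> e" "f' = \<phi> f" "p' = \<phi> p" "g1' = \<phi> g1" "g2' = \<phi> g2"
    and c: "e \<in> carrier G" "f \<in> carrier G" "p \<in> carrier G" "g1 \<in> carrier G" "g2 \<in> carrier G"
    by blast
  have 1: "e \<in> tops G" "f \<in> tops G" "p \<in> tops G" "g1 \<in> right_ids G" "g2 \<in> right_ids G"
    using mem T R c by (auto simp: eq)
  have 2: "g1 \<noteq> g2" "e \<otimes>\<^bsub>G\<^esub> p = g1 \<otimes>\<^bsub>G\<^esub> e" "f \<otimes>\<^bsub>G\<^esub> p = g2 \<otimes>\<^bsub>G\<^esub> f"
    using eqs' mult_eq inj_eq c by (auto simp: eq)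
  have 3: "(\<exists>q\<in>carrier G. h \<otimes>\<^bsub>G\<^esub> q = g1 \<otimes>\<^bsub>G\<^esub> h) \<longleftrightarrow>
      (\<exists>q\<in>carrier G. h \<otimes>\<^bsub>G\<^esub> q = g2 \<otimes>\<^bsub>G\<^esub> h)" if "h \<in> tops G" for h
  proof -
    have "h \<in> carrier G" using that tc by blast
    then show ?thesis
      using all'[unfolded inseparable_def, rule_format, of "\<phi> h"] that T c
      by (simp add: eq surj mult_eq)
  qed
  then have "inseparable G g1 g2" by (simp add: inseparable_def)
  with 1 2 show ?thesis unfolding crossing_def by blast
qed

section \<open>The algebraic notions in a canonical cross-section\<close>

context canonical_section
begin

abbreviation G where "G \<equiv> brauer_monoid_on n \<Lambda>"

lemma G_simps [simp]: "carrier G = \<Lambda>" "x \<otimes>\<^bsub>G\<^esub> y = brauer_mult x y"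
  by (simp_all add: brauer_monoid_on_def)

lemma one_arc_same: "one_arc x i j \<Longrightarrow> one_arc x k l \<Longrightarrow> {i, j} = {k, l}"
  using one_arc_unique[of x k l i j] one_arcD(3)[of x i j] by blast

lemma corank_even:
  assumes "x \<in> \<Lambda>" obtains k where "corank n x = 2 * k"
  using corank_arcs[OF in_brauer[OF assms]] by blast

lemma absorb_arc:
  assumes "x \<in> \<Lambda>" "one_arc t i j" "n < corank n x + i"
  shows "brauer_mult x t = x"
proof -
  obtain k where k: "corank n x = 2 * k" using corank_even[OF assms(1)] .
  then have "n - 2 * k < i" "i \<le> n" using assms(3) one_arcD(4)[OF assms(2)] by auto
  then obtain i' where "joined x (Rgt i) (Rgt i')" using right_arcs[OF assms(1) k] by blast
  then show ?thesis using absorb assms by blast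
qed

text \<open>Without left arcs, \<open>x\<close> is a permutation, and \<open>x t = x\<close> would
  pull any left arc of \<open>t\<close> back to \<open>x\<close>; so \<open>t\<close> has no left
  arcs either and equals \<open>x\<close>. With a left arc, \<open>x\<close> absorbs several
  elements.\<close>

lemma nonunits_iff: "x \<in> nonunits G \<longleftrightarrow> x \<in> \<Lambda> \<and> (\<exists>i j. joined x (Lft i) (Lft j))"
proof (cases "x \<in> \<Lambda>")
  case x: True
  note bx = in_brauer[OF x]
  show ?thesis
  proof
    assume "x \<in> nonunits G"
    then obtain t where t: "t \<in> \<Lambda>" "t \<noteq> x" "brauer_mult x t = x" by (auto simp: nonunits_def)
    have "\<exists>i j. joined x (Lft i) (Lft j)"
    proof (rule ccontr)
      assume no: "\<not> ?thesis"
      then have "corank n x = 2 * 0" by (simp add: corank_left[OF bx])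
      note full = right_transversal[OF x this]
      have not: "\<not> joined t (Lft p) (Lft q)" for p q
      proof
        assume pq: "joined t (Lft p) (Lft q)"
        have pq': "p \<in> {1..n}" "q \<in> {1..n}" "p \<noteq> q"
          using joined_index[OF in_brauer[OF t(1)]] joined_neq[OF in_brauer[OF t(1)] pq] pq by blast+
        obtain a where a: "joined x (Lft a) (Rgt p)" using full[of p] pq' by auto
        obtain b where b: "joined x (Lft b) (Rgt q)" using full[of q] pq' by auto
        have "a \<noteq> b" using joined_unique[OF bx a] b pq' by blast
        then show False using mult_pullback[OF a pq b] no t(3) by auto
      qed
      have "x = t"
      proof (rule eqI[OF x t(1)])
        show "joined t (Lft u) (Lft v)" if "joined x (Lft u) (Lft v)" for u v
          using that no by blast
        show "\<exists>w. joined t (Lft u) (Rgt w)" if "joined x (Lft u) (Rgt v)" for u v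
          using joined_Lft_cases[OF in_brauer[OF t(1)]] joined_index(1)[OF bx that] not by metis
      qed
      then show False using t(2) by simp
    qed
    then show "x \<in> \<Lambda> \<and> (\<exists>i j. joined x (Lft i) (Lft j))" using x by simp
  next
    assume "x \<in> \<Lambda> \<and> (\<exists>i j. joined x (Lft i) (Lft j))"
    then have "corank n x \<ge> 2" using corank_ge_2[OF bx] by blast
    \<comment> \<open>Two distinct absorbed elements are produced, since \<open>x\<close> itself may
      be one of them.\<close>
    obtain s where s: "one_arc s n (n - 1)" by (rule one_arc_ex[of n "n - 1"]) (use n6 in auto)
    obtain t where t: "one_arc t n 1" by (rule one_arc_ex[of n 1]) (use n6 in auto)
    have "s \<noteq> t" using one_arc_same[OF s, of n 1] t n6 by (auto simp: doubleton_eq_iff)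
    moreover have "brauer_mult x s = x" "brauer_mult x t = x"
      using absorb_arc[OF x] s t \<open>corank n x \<ge> 2\<close> by auto
    ultimately show "x \<in> nonunits G"
      using x one_arcD(1)[OF s] one_arcD(1)[OF t] by (auto simp: nonunits_def)
  qed
qed (simp add: nonunits_def)

lemma one_arc_nonunit: "one_arc x i j \<Longrightarrow> x \<in> nonunits G"
  unfolding nonunits_iff using one_arcD(1,3) by blast

text \<open>A left arc of \<open>t\<close> avoiding \<open>n - 1\<close> and \<open>n\<close> would
  join two transversals of \<open>x\<close>. So would two arcs starting at \<open>n - 1\<close> and
  at \<open>n\<close>, because the right arc of \<open>x\<close> links these pins.\<close>

lemma stabilizer:
  assumes x: "one_arc x i j" and t: "t \<in> \<Lambda>" "brauer_mult x t = x" and pq: "joined t (Lft p) (Lft q)"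
  shows "\<exists>u v. one_arc t u v \<and> u \<in> {n - 1, n}"
proof -
  note bx = one_arcD(2)[OF x] and bt = in_brauer[OF t(1)]
  have tr: "\<exists>a. joined x (Lft a) (Rgt u)" if "u \<in> {1..n}" "u \<notin> {n - 1, n}" for u
  proof -
    have "u \<in> {1..n - 2 * 1}" using that by auto
    from right_transversal[OF one_arcD(1)[OF x] _ this] one_arcD(7)[OF x] show ?thesis by auto
  qed
  have meets: "u \<in> {n - 1, n} \<or> v \<in> {n - 1, n}" if uv: "joined t (Lft u) (Lft v)" for u v
  proof (rule ccontr)
    assume no: "\<not> ?thesis"
    obtain a where a: "joined x (Lft a) (Rgt u)" using tr[of u] joined_index(1)[OF bt uv] no by blast
    obtain b where b: "joined x (Lft b) (Rgt v)" using tr[of v] joined_index(3)[OF bt uv] no by blast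
    have "a \<noteq> b" using joined_unique[OF bx a] b joined_neq[OF bt uv] by auto
    then have "joined x (Lft a) (Lft b)" using mult_pullback[OF a uv b] t(2) by simp
    then show False using joined_unique[OF bx a] by blast
  qed
  have main: "one_arc t p q" if pq: "joined t (Lft p) (Lft q)" and p: "p \<in> {n - 1, n}" for p q
  proof (rule one_arcI[OF t(1) pq])
    have *: "{u, v} = {p, q}" if uv: "joined t (Lft u) (Lft v)" and u: "u \<in> {n - 1, n}" for u v
    proof (cases "u = p \<or> u = q")
      case True
      then show ?thesis
        using joined_unique[OF bt uv] pq joined_sym[OF pq] by blast
    next
      case False
      have "v \<noteq> p" "v \<noteq> q" "u \<noteq> v" "p \<noteq> q"
        using False joined_unique_left[OF bt uv] pq joined_sym[OF pq] joined_neq[OF bt uv]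
          joined_neq[OF bt pq] by blast+
      \<comment> \<open>The distinct pins \<open>p\<close> and \<open>u\<close> exhaust
        \<open>{n - 1, n}\<close>, so the far ends \<open>q\<close> and \<open>v\<close> are met by
        transversals of \<open>x\<close>.\<close>
      then have "q \<notin> {n - 1, n}" "v \<notin> {n - 1, n}" using False p u by auto
      then obtain a b where a: "joined x (Lft a) (Rgt q)" and b: "joined x (Lft b) (Rgt v)"
        using tr[of q] tr[of v] joined_index(3)[OF bt uv] joined_index(3)[OF bt pq] by blast
      have "a \<noteq> b" using joined_unique[OF bx a] b \<open>v \<noteq> q\<close> by auto
      moreover have "joined x (Rgt p) (Rgt u)"
        using one_arc_right[OF x] joined_sym[OF one_arc_right[OF x]] p u False by auto
      ultimately have "joined x (Lft a) (Lft b)"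
        using mult_LL_zigzag[OF a joined_sym[OF pq] _ uv b] t(2) by simp
      then show ?thesis using joined_unique[OF bx a] by blast
    qed
    show "{u, v} = {p, q}" if uv: "joined t (Lft u) (Lft v)" for u v
      using meets[OF uv] *[OF uv] *[OF joined_sym[OF uv]] by (auto simp: insert_commute)
  qed
  show ?thesis using meets[OF pq] main[OF pq] main[OF joined_sym[OF pq]] by blast
qed

text \<open>Being absorbed by \<open>\<alpha>\<^sub>1\<^sub>,\<^sub>2\<close> alone already forces
  this form, by \<open>stabilizer\<close>. Conversely, every nonunit has \<open>n - 1\<close> and
  \<open>n\<close> on right arcs.\<close>

lemma right_ids_iff: "s \<in> right_ids G \<longleftrightarrow> (\<exists>i j. one_arc s i j \<and> i \<in> {n - 1, n})"
proof
  assume s: "s \<in> right_ids G"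
  obtain x where x: "one_arc x 1 2" by (rule one_arc_ex[of 1 2]) (use n6 in auto)
  have "brauer_mult x s = x" using s one_arc_nonunit[OF x] by (simp add: right_ids_def)
  moreover have "s \<in> nonunits G" using s by (simp add: right_ids_def)
  then have "s \<in> \<Lambda>" "\<exists>p q. joined s (Lft p) (Lft q)" by (simp_all add: nonunits_iff)
  ultimately show "\<exists>i j. one_arc s i j \<and> i \<in> {n - 1, n}" using stabilizer[OF x] by blast
next
  assume "\<exists>i j. one_arc s i j \<and> i \<in> {n - 1, n}"
  then obtain i j where s: "one_arc s i j" "i \<in> {n - 1, n}" by blast
  have "brauer_mult x s = x" if "x \<in> nonunits G" for x
  proof -
    have x: "x \<in> \<Lambda>" using that nonunits_iff by blast
    then have "corank n x \<ge> 2" using that nonunits_iff corank_ge_2[OF in_brauer[OF x]] by blast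
    then show ?thesis using absorb_arc[OF x s(1)] s(2) n6 by auto
  qed
  then show "s \<in> right_ids G" using one_arc_nonunit[OF s(1)] by (simp add: right_ids_def)
qed

lemma tops_iff:
  "x \<in> tops G \<longleftrightarrow> (\<exists>i j. one_arc x i j \<and> i \<in> {1..n - 2} \<and> j \<in> {1..n - 2})"
proof
  assume x: "x \<in> tops G"
  then have "x \<in> nonunits G" by (simp add: tops_def)
  then have xL: "x \<in> \<Lambda>" and "\<exists>i j. joined x (Lft i) (Lft j)" by (simp_all add: nonunits_iff)
  then obtain i j where ij: "joined x (Lft i) (Lft j)" by blast
  have "{u, v} = {i, j}" if uv: "joined x (Lft u) (Lft v)" for u v
  proof (rule ccontr)
    assume "{u, v} \<noteq> {i, j}"
    then have 4: "corank n x \<ge> 4" using corank_ge_4[OF in_brauer[OF xL] uv ij] by blast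
    \<comment> \<open>An element of corank at least 4 absorbs this \<open>t\<close>, which is not in
      \<open>right_ids\<close>. This excludes a second arc.\<close>
    obtain t where t: "one_arc t (n - 2) (n - 3)" by (rule one_arc_ex[of "n - 2" "n - 3"]) (use n6 in auto)
    have "brauer_mult x t = x" using absorb_arc[OF xL t] 4 n6 by auto
    then have "t \<in> right_ids G" using x one_arc_nonunit[OF t] by (simp add: tops_def)
    then obtain p q where "one_arc t p q" "p \<in> {n - 1, n}" using right_ids_iff by blast
    then show False using one_arc_same[OF t, of p q] n6 by (auto simp: doubleton_eq_iff)
  qed
  then have one: "one_arc x i j" using one_arcI[OF xL ij] by blast
  then have "i \<notin> {n - 1, n}" "j \<notin> {n - 1, n}"
    using x one_arc_sym right_ids_iff unfolding tops_def by blast+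
  then have "i \<in> {1..n - 2}" "j \<in> {1..n - 2}" using one_arcD(4,5)[OF one] by auto
  then show "\<exists>i j. one_arc x i j \<and> i \<in> {1..n - 2} \<and> j \<in> {1..n - 2}" using one by blast
next
  assume "\<exists>i j. one_arc x i j \<and> i \<in> {1..n - 2} \<and> j \<in> {1..n - 2}"
  then obtain i j where x: "one_arc x i j" and ij: "i \<in> {1..n - 2}" "j \<in> {1..n - 2}" by blast
  have "x \<notin> right_ids G"
  proof
    assume "x \<in> right_ids G"
    then obtain p q where "one_arc x p q" "p \<in> {n - 1, n}" using right_ids_iff by blast
    then show False using one_arc_same[OF x, of p q] ij n6 by (auto simp: doubleton_eq_iff)
  qed
  moreover have "t \<in> right_ids G" if "t \<in> nonunits G" "brauer_mult x t = x" for t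
    using that nonunits_iff stabilizer[OF x] right_ids_iff by blast
  ultimately show "x \<in> tops G" using one_arc_nonunit[OF x] by (simp add: tops_def)
qed

section \<open>Exchange identities\<close>

text \<open>By \<open>two_arcs\<close>, both products have exactly the left arcs
  \<open>{i, j}\<close> and \<open>{k, l}\<close>.\<close>

lemma exchange:
  assumes x: "one_arc x i j" and y: "one_arc y k l" and p: "one_arc p k' l'" and q: "one_arc q i' j'"
    and "joined x (Lft k) (Rgt k')" "joined x (Lft l) (Rgt l')"
    and "joined y (Lft i) (Rgt i')" "joined y (Lft j) (Rgt j')"
  shows "brauer_mult x p = brauer_mult y q"
proof (rule arcs_determine)
  show xp: "brauer_mult x p \<in> \<Lambda>" and yq: "brauer_mult y q \<in> \<Lambda>"
    using mult_closed one_arcD(1) x y p q by blast+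
  have "joined (brauer_mult x p) (Lft u) (Lft v) \<longleftrightarrow> joined (brauer_mult y q) (Lft u) (Lft v)" for u v
    unfolding two_arcs(1)[OF x p assms(5,6)] two_arcs(1)[OF y q assms(7,8)] by (rule disj_commute)
  then show "left_arcs n (brauer_mult x p) = left_arcs n (brauer_mult y q)"
    using left_arcs_iff[OF in_brauer[OF xp]] left_arcs_iff[OF in_brauer[OF yq]] by auto
qed

lemma transversals_of_pair:
  assumes x: "one_arc x i j" and "k \<in> {1..n - 2}" "l \<in> {1..n - 2}"
  obtains a b where "joined x (Lft a) (Rgt k)" "joined x (Lft b) (Rgt l)"
proof -
  have "corank n x = 2 * 1" using one_arcD(7)[OF x] by simp
  note tr = right_transversal[OF one_arcD(1)[OF x] this]
  obtain a where a: "joined x (Lft a) (Rgt k)" by (rule tr[of k]) (use assms(2) in simp_all)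
  obtain b where b: "joined x (Lft b) (Rgt l)" by (rule tr[of l]) (use assms(3) in simp_all)
  from a b show thesis by (rule that)
qed

text \<open>The arc of \<open>y\<close> survives in the common product. Since it is not the arc of
  \<open>x\<close>, it must be the pullback of the arc of \<open>p\<close>.\<close>

lemma exchangeD:
  assumes x: "one_arc x i j" and p: "one_arc p k' l'" and kl': "k' \<in> {1..n - 2}" "l' \<in> {1..n - 2}"
    and y: "one_arc y k l" and eq: "brauer_mult x p = brauer_mult y q" and ne: "{k, l} \<noteq> {i, j}"
  obtains a b where "joined x (Lft k) (Rgt a)" "joined x (Lft l) (Rgt b)" "{a, b} = {k', l'}"
proof -
  obtain a b where ab: "joined x (Lft a) (Rgt k')" "joined x (Lft b) (Rgt l')"
    using transversals_of_pair[OF x kl'] .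
  have "joined (brauer_mult x p) (Lft k) (Lft l)"
    using mult_LL[OF one_arcD(2)[OF y] one_arcD(3)[OF y]] eq by simp
  then have "{k, l} = {a, b}" using two_arcs(1)[OF x p ab] ne by blast
  then consider "k = a" "l = b" | "k = b" "l = a" by (auto simp: doubleton_eq_iff)
  then show thesis using that ab by cases blast+
qed

section \<open>Transversals forced by canonicity\<close>

lemma corank4_exists: obtains z where "z \<in> \<Lambda>" "corank n z = 4"
proof -
  obtain x where x: "one_arc x 1 2" by (rule one_arc_ex[of 1 2]) (use n6 in auto)
  obtain a b where "joined x (Lft a) (Rgt 1)" "joined x (Lft b) (Rgt 2)"
    by (rule transversals_of_pair[OF x, of 1 2]) (use n6 in auto)
  then have "corank n (brauer_mult x x) = 4" by (rule two_arcs(2)[OF x x])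
  then show thesis using that mult_closed one_arcD(1)[OF x] by blast
qed

lemma right_id_fixes:
  assumes "one_arc g i j" "i \<in> {n - 1, n}" "y \<in> {1..n - 2}" "y \<noteq> j"
  shows "joined g (Lft y) (Rgt y)"
proof -
  obtain x where x: "one_arc x 1 2" by (rule one_arc_ex[of 1 2]) (use n6 in auto)
  show ?thesis
    using absorb_fixes[OF one_arcD(1)[OF x] _ assms(1), of 1 y] one_arcD(7)[OF x] assms n6 by auto
qed

text \<open>Elements of corank 4 have right arcs on the last four pins, so they absorb one-arc
  elements whose arc meets \<open>n - 2\<close>.\<close>

lemma next_block_fixes:
  assumes "one_arc g (n - 2) j" "y \<in> {1..n - 4}" "y \<noteq> j"
  shows "joined g (Lft y) (Rgt y)"
proof -
  obtain z where z: "z \<in> \<Lambda>" "corank n z = 4" using corank4_exists .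
  show ?thesis
    using absorb_fixes[OF z(1) _ assms(1), of 2 y] z(2) assms n6 by auto
qed

text \<open>In the square of \<open>e\<close>, which has corank 4, the right arc of the first factor
  is pushed to \<open>{c, d}\<close> and so lies in the last four pins. The last two already carry
  the right arc of the second factor.\<close>

lemma last_block:
  assumes e: "one_arc e i j" "i \<in> {1..n - 2}" "j \<in> {1..n - 2}"
  obtains c d where "joined e (Lft (n - 1)) (Rgt c)" "joined e (Lft n) (Rgt d)" "{c, d} = {n - 3, n - 2}"
proof -
  note be = one_arcD(2)[OF e(1)]
  let ?y = "brauer_mult e e"
  obtain a b where ab: "joined e (Lft a) (Rgt i)" "joined e (Lft b) (Rgt j)"
    using transversals_of_pair[OF e] .
  have y: "?y \<in> \<Lambda>" "corank n ?y = 2 * 2"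
    using two_arcs(2)[OF e(1) e(1) ab] mult_closed one_arcD(1)[OF e(1)] by auto
  obtain c where c: "joined e (Lft (n - 1)) (Rgt c)"
    by (rule one_arc_off[OF e(1), of "n - 1"]) (use e n6 in auto)
  obtain d where d: "joined e (Lft n) (Rgt d)"
    by (rule one_arc_off[OF e(1), of n]) (use e n6 in auto)
  note r = one_arc_right[OF e(1)]
  have ne: "c \<noteq> d" using joined_unique_left[OF be c] d n6 by fastforce
  have cd: "joined ?y (Rgt c) (Rgt d)" by (rule mult_push[OF c r d ne])
  have range: "n - 2 * 2 < c" "c \<le> n" "n - 2 * 2 < d" "d \<le> n"
    using right_arcs[OF y] cd joined_sym[OF cd] by blast+
  have "a = n - 3 \<or> a = n - 2" if "n - 2 * 2 < a" "a \<le> n" "joined e (Lft b) (Rgt a)" for a b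
  proof -
    have "a \<noteq> n" "a \<noteq> n - 1"
      using joined_unique_left[OF be that(3)] r joined_sym[OF r] by blast+
    with that(1,2) show ?thesis by linarith
  qed
  then have "c = n - 3 \<or> c = n - 2" "d = n - 3 \<or> d = n - 2" using range c d by blast+
  then have "{c, d} = {n - 3, n - 2}" using ne by (elim disjE) (simp_all add: insert_commute)
  then show thesis using that c d by blast
qed

section \<open>Reading off the twist\<close>

lemma elem2_eq:
  assumes x: "one_arc x i j"
  shows "elem2 n \<Lambda> i j = x"
  unfolding elem2_def
proof (rule the_equality)
  show "x \<in> \<Lambda> \<and> corank n x = 2 \<and> joined x (Lft i) (Lft j)" using one_arcD[OF x] by blast
  fix y assume y: "y \<in> \<Lambda> \<and> corank n y = 2 \<and> joined y (Lft i) (Lft j)"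
  then have "{u, v} = {i, j}" if "joined y (Lft u) (Lft v)" for u v
    using corank_ge_4[OF in_brauer _ that] by fastforce
  then have "one_arc y i j" using one_arcI y by blast
  then show "y = x" using one_arc_eq x by blast
qed

lemma admissible_1: "1 \<le> i \<Longrightarrow> i < j \<Longrightarrow> j \<le> n - 2 \<Longrightarrow> admissible n i j 1"
  using n6 by (auto simp: admissible_def)

text \<open>The twist at \<open>l = 1\<close> gives the image of \<open>n\<close>, and
  \<open>last_block\<close> leaves one value for that of \<open>n - 1\<close>.\<close>

lemma twist_id:
  assumes e: "one_arc e i j" "1 \<le> i" "i < j" "j \<le> n - 2" and tw: "twist n \<Lambda> i j 1 = id"
  shows "joined e (Lft n) (Rgt (n - 2)) \<and> joined e (Lft (n - 1)) (Rgt (n - 3))"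
proof -
  have nn: "n - 2 * 1 = n - 2" "n - 2 + 2 = n" "n - 2 - 1 = n - 3" using n6 by auto
  \<comment> \<open>The three possible values of \<open>twist\<close> are distinct, so the value
    \<open>id\<close> can come only from the first branch.\<close>
  have "(\<lambda>_. 0) \<noteq> (id :: nat \<Rightarrow> nat)" "transpose 1 2 \<noteq> (id :: nat \<Rightarrow> nat)"
    by (metis id_apply zero_neq_one, metis id_apply transpose_apply_first one_eq_numeral_iff numeral_One semiring_norm(85))
  then have n: "joined e (Lft n) (Rgt (n - 2))"
    using tw unfolding twist_def elem2_eq[OF e(1)] nn by metis
  obtain c d where cd: "joined e (Lft (n - 1)) (Rgt c)" "joined e (Lft n) (Rgt d)" "{c, d} = {n - 3, n - 2}"
    by (rule last_block[OF e(1)]) (use e(2-4) in auto)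
  have "d = n - 2" using joined_unique[OF one_arcD(2)[OF e(1)] cd(2) n] by simp
  then have "c = n - 3" using cd(3) n6 by (auto simp: doubleton_eq_iff)
  with cd n show ?thesis by simp
qed

lemma twist_swap:
  assumes e: "one_arc e i j" "1 \<le> i" "i < j" "j \<le> n - 2" and tw: "twist n \<Lambda> i j 1 = transpose 1 2"
  shows "joined e (Lft n) (Rgt (n - 3)) \<and> joined e (Lft (n - 1)) (Rgt (n - 2))"
proof -
  have nn: "n - 2 * 1 = n - 2" "n - 2 + 2 = n" "n - 2 - 1 = n - 3" using n6 by auto
  have "(\<lambda>_. 0) \<noteq> (transpose 1 2 :: nat \<Rightarrow> nat)" "id \<noteq> (transpose 1 2 :: nat \<Rightarrow> nat)"
    by (metis transpose_apply_first zero_neq_numeral, metis id_apply transpose_apply_first one_eq_numeral_iff numeral_One semiring_norm(85))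
  then have n: "joined e (Lft n) (Rgt (n - 3))"
    using tw unfolding twist_def elem2_eq[OF e(1)] nn by metis
  obtain c d where cd: "joined e (Lft (n - 1)) (Rgt c)" "joined e (Lft n) (Rgt d)" "{c, d} = {n - 3, n - 2}"
    by (rule last_block[OF e(1)]) (use e(2-4) in auto)
  have "d = n - 3" using joined_unique[OF one_arcD(2)[OF e(1)] cd(2) n] by simp
  then have "c = n - 2" using cd(3) n6 by (auto simp: doubleton_eq_iff)
  with cd n show ?thesis by simp
qed

text \<open>A common product has both \<open>{i, j}\<close> and \<open>{u, v}\<close> as left arcs,
  so they cannot share just \<open>v\<close>. Conversely, if \<open>v\<close> avoids
  \<open>{i, j}\<close>, then \<open>g\<close> fixes \<open>i\<close> and \<open>j\<close>, and
  \<open>q\<close> is the one-arc element at the image of \<open>{u, v}\<close> under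
  \<open>h\<close>.\<close>

lemma exchange_iff:
  assumes h: "one_arc h i j" "i \<in> {1..n - 2}" "j \<in> {1..n - 2}" and g: "one_arc g u v" "u \<in> {n - 1, n}"
  shows "(\<exists>q\<in>\<Lambda>. brauer_mult h q = brauer_mult g h) \<longleftrightarrow> v \<notin> {i, j}"
proof
  assume "\<exists>q\<in>\<Lambda>. brauer_mult h q = brauer_mult g h"
  then obtain q where q: "q \<in> \<Lambda>" "brauer_mult h q = brauer_mult g h" by blast
  have y: "brauer_mult h q \<in> brauer n" using mult_closed one_arcD(1)[OF h(1)] q(1) in_brauer by blast
  have ij: "joined (brauer_mult h q) (Lft i) (Lft j)"
    using mult_LL one_arcD[OF h(1)] by blast
  have uv: "joined (brauer_mult h q) (Lft u) (Lft v)"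
    using mult_LL one_arcD[OF g(1)] q(2) by metis
  have "u \<notin> {i, j}" using h g(2) n6 by auto
  then show "v \<notin> {i, j}" using joined_unique_left[OF y uv] ij joined_sym[OF ij] by blast
next
  assume v: "v \<notin> {i, j}"
  have u: "u \<notin> {i, j}" using h g(2) n6 by auto
  note bh = one_arcD(2)[OF h(1)]
  obtain u' where u': "joined h (Lft u) (Rgt u')" using one_arc_off[OF h(1) one_arcD(4)[OF g(1)] u] .
  obtain v' where v': "joined h (Lft v) (Rgt v')" using one_arc_off[OF h(1) one_arcD(5)[OF g(1)] v] .
  have "u' \<noteq> v'" using joined_unique_left[OF bh u'] v' one_arcD(6)[OF g(1)] by blast
  moreover have "u' \<in> {1..n}" "v' \<in> {1..n}" using joined_index[OF bh] u' v' by blast+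
  ultimately obtain q where q: "one_arc q u' v'" using one_arc_ex by blast
  have "joined g (Lft i) (Rgt i)" "joined g (Lft j) (Rgt j)"
    using right_id_fixes[OF g] h v by auto
  then have "brauer_mult h q = brauer_mult g h"
    by (rule exchange[OF h(1) g(1) q h(1) u' v'])
  then show "\<exists>q\<in>\<Lambda>. brauer_mult h q = brauer_mult g h" using one_arcD(1)[OF q] by blast
qed

section \<open>The invariant separates the two cases\<close>

text \<open>All \<open>a\<^sub>e\<close> with \<open>e\<close> in \<open>{1..n - 2}\<close> act
  alike on \<open>n - 1\<close> and \<open>n\<close>. A coincidence at different pins
  \<open>u\<close> and \<open>u'\<close> would then force \<open>v\<close> itself into
  \<open>{n - 1, n}\<close>.\<close>

lemma regular_not_crossing:
  assumes "regular n \<Lambda>"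
  shows "\<not> crossing G"
proof
  have blk: "joined e (Lft n) (Rgt (n - 2)) \<and> joined e (Lft (n - 1)) (Rgt (n - 3))"
    if e: "one_arc e i j" "i \<in> {1..n - 2}" "j \<in> {1..n - 2}" for e i j
  proof -
    have lt: ?thesis if "one_arc e i j" "i < j" "1 \<le> i" "j \<le> n - 2" for i j
      using twist_id[OF that(1,3,2,4)] assms admissible_1[OF that(3,2,4)] by (simp add: regular_def)
    have "i < j \<or> j < i" using one_arcD(6)[OF e(1)] by auto
    then show ?thesis using lt[of i j] lt[of j i] e one_arc_sym by auto
  qed
  assume "crossing G"
  then obtain e f p g g' where mem: "e \<in> tops G" "f \<in> tops G" "p \<in> tops G"
      "g \<in> right_ids G" "g' \<in> right_ids G"
    and ne: "g \<noteq> g'" and ep: "brauer_mult e p = brauer_mult g e" and fp: "brauer_mult f p = brauer_mult g' f"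
    and all: "inseparable G g g'"
    unfolding crossing_def G_simps by blast
  obtain i j where e: "one_arc e i j" "i \<in> {1..n - 2}" "j \<in> {1..n - 2}" using mem(1) tops_iff by blast
  obtain i' j' where f: "one_arc f i' j'" "i' \<in> {1..n - 2}" "j' \<in> {1..n - 2}" using mem(2) tops_iff by blast
  obtain k l where p: "one_arc p k l" "k \<in> {1..n - 2}" "l \<in> {1..n - 2}" using mem(3) tops_iff by blast
  obtain u v where g: "one_arc g u v" "u \<in> {n - 1, n}" using mem(4) right_ids_iff by blast
  obtain u' v' where g': "one_arc g' u' v'" "u' \<in> {n - 1, n}" using mem(5) right_ids_iff by blast
  have sep: "v \<notin> {a, b} \<longleftrightarrow> v' \<notin> {a, b}" if ab: "a \<in> {1..n - 2}" "b \<in> {1..n - 2}" "a \<noteq> b" for a b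
  proof -
    obtain h where h: "one_arc h a b" by (rule one_arc_ex[of a b]) (use ab in auto)
    then have "h \<in> tops G" using tops_iff ab by blast
    then show ?thesis
      using all exchange_iff[OF h ab(1,2) g] exchange_iff[OF h ab(1,2) g'] by (simp add: inseparable_def)
  qed
  \<comment> \<open>An auxiliary pin for test arcs: \<open>{v, b}\<close> would separate
    \<open>v\<close> from a different \<open>v'\<close> whenever \<open>v \<le> n - 2\<close>, and
    likewise with the roles exchanged.\<close>
  have pick: "\<exists>b\<in>{1..n - 2}. b \<noteq> v \<and> b \<noteq> v'"
  proof -
    have "{1, 2, 3} \<subseteq> {1..n - 2}" using n6 by auto
    moreover have "\<exists>b\<in>{1, 2, 3}. b \<noteq> v \<and> b \<noteq> v'" by auto
    ultimately show ?thesis by blast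
  qed
  have v: "v = v' \<and> v \<in> {1..n - 2}"
  proof (rule ccontr)
    assume no: "\<not> ?thesis"
    \<comment> \<open>In the remaining case both \<open>g\<close> and \<open>g'\<close> have the arc
      \<open>{n - 1, n}\<close> and therefore coincide.\<close>
    have "v \<notin> {1..n - 2} \<and> v' \<notin> {1..n - 2}" using pick sep no by blast
    then have "v \<in> {n - 1, n}" "v' \<in> {n - 1, n}"
      using one_arcD(5)[OF g(1)] one_arcD(5)[OF g'(1)] by auto
    then have "{u, v} = {u', v'}"
      using g g' one_arcD(6)[OF g(1)] one_arcD(6)[OF g'(1)] by auto
    then consider "u = u'" "v = v'" | "u = v'" "v = u'" by (auto simp: doubleton_eq_iff)
    then have "one_arc g' u v" using g' one_arc_sym by cases auto
    then show False using one_arc_eq[OF g(1)] ne by blast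
  qed
  then have "u \<noteq> u'" using one_arc_eq[OF g(1)] g'(1) ne by blast
  have "{u, v} \<noteq> {i, j}" "{u', v'} \<noteq> {i', j'}" using g g' e f n6 by (auto simp: doubleton_eq_iff)
  then obtain a b a' b' where ab: "joined e (Lft u) (Rgt a)" "joined e (Lft v) (Rgt b)" "{a, b} = {k, l}"
    and ab': "joined f (Lft u') (Rgt a')" "joined f (Lft v') (Rgt b')" "{a', b'} = {k, l}"
    using exchangeD[OF e(1) p g(1) ep] exchangeD[OF f(1) p g'(1) fp] by metis
  note E = blk[OF e] and F = blk[OF f] and be = one_arcD(2)[OF e(1)] and bf = one_arcD(2)[OF f(1)]
  have "u = n \<and> a = n - 2 \<or> u = n - 1 \<and> a = n - 3"
    using g(2) joined_unique[OF be ab(1)] E by auto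
  moreover have "u' = n \<and> a' = n - 2 \<or> u' = n - 1 \<and> a' = n - 3"
    using g'(2) joined_unique[OF bf ab'(1)] F by auto
  ultimately have "a \<noteq> a'" "a' \<in> {n - 2, n - 3}" using \<open>u \<noteq> u'\<close> n6 by auto
  \<comment> \<open>Since \<open>{a, b} = {a', b'}\<close> and \<open>a \<noteq> a'\<close>, the
    image \<open>b\<close> of \<open>v\<close> equals \<open>a'\<close>. But
    \<open>a\<^sub>e\<close> sends only \<open>n - 1\<close> and \<open>n\<close> to these two
    values.\<close>
  then have "b = n - 2 \<or> b = n - 3" using ab(3) ab'(3) by (auto simp: doubleton_eq_iff)
  then have "v = n \<or> v = n - 1" using joined_unique_left[OF be ab(2)] E by blast
  then show False using v n6 by auto
qed

lemma alternating_crossing: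
  assumes "alternating n \<Lambda>"
  shows "crossing G"
proof -
  have tw: "twist n \<Lambda> i j 1 = (if (i, j) \<in> exceptional_pairs n then id else transpose 1 2)"
    if "1 \<le> i" "i < j" "j \<le> n - 2" for i j
    using assms admissible_1[OF that] by (simp add: alternating_def)
  \<comment> \<open>The arcs of \<open>e\<close> and \<open>f\<close> are written with
    \<open>n - 2\<close> first to match \<open>next_block_fixes\<close>. The arc of \<open>e\<close>
    is the exceptional pair for \<open>m = 1\<close>, and \<open>v = 2\<close> is the common end of
    \<open>g\<close> and \<open>g'\<close>.\<close>
  obtain e where e: "one_arc e (n - 2) (n - 3)" by (rule one_arc_ex[of "n - 2" "n - 3"]) (use n6 in auto)
  obtain f where f: "one_arc f (n - 2) 1" by (rule one_arc_ex[of "n - 2" 1]) (use n6 in auto)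
  obtain g where g: "one_arc g n 2" by (rule one_arc_ex[of n 2]) (use n6 in auto)
  obtain g' where g': "one_arc g' (n - 1) 2" by (rule one_arc_ex[of "n - 1" 2]) (use n6 in auto)
  obtain p where p: "one_arc p (n - 2) 2" by (rule one_arc_ex[of "n - 2" 2]) (use n6 in auto)
  have "(n - 3, n - 2) \<in> exceptional_pairs n"
    unfolding exceptional_pairs_def using n6 by (intro CollectI exI[of _ 1]) auto
  then have E: "joined e (Lft n) (Rgt (n - 2))"
    using twist_id[OF one_arc_sym[OF e]] tw[of "n - 3" "n - 2"] n6 by auto
  have "(1, n - 2) \<notin> exceptional_pairs n" using n6 by (auto simp: exceptional_pairs_def)
  then have F: "joined f (Lft (n - 1)) (Rgt (n - 2))"
    using twist_swap[OF one_arc_sym[OF f]] tw[of 1 "n - 2"] n6 by auto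
  \<comment> \<open>The bound \<open>n \<ge> 6\<close> gives \<open>2 \<le> n - 4\<close>, and 2
    lies on neither arc.\<close>
  have E2: "joined e (Lft 2) (Rgt 2)" "joined f (Lft 2) (Rgt 2)"
    using next_block_fixes[OF e, of 2] next_block_fixes[OF f, of 2] n6 by auto
  have G: "joined g (Lft y) (Rgt y)" "joined g' (Lft y) (Rgt y)" if "y \<in> {1..n - 2}" "y \<noteq> 2" for y
    using right_id_fixes[OF g] right_id_fixes[OF g'] that by auto
  have ep: "brauer_mult e p = brauer_mult g e"
    by (rule exchange[OF e g p e E E2(1)]; rule G) (use n6 in auto)
  have fp: "brauer_mult f p = brauer_mult g' f"
    by (rule exchange[OF f g' p f F E2(2)]; rule G) (use n6 in auto)
  have "g \<noteq> g'"
    using one_arc_same[OF g, of "n - 1" 2] g' n6 by (auto simp: doubleton_eq_iff)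
  moreover have "e \<in> tops G" "f \<in> tops G" "p \<in> tops G"
    using tops_iff e f p n6 by (fastforce)+
  moreover have "g \<in> right_ids G" "g' \<in> right_ids G" using right_ids_iff g g' by blast+
  \<comment> \<open>By \<open>exchange_iff\<close>, both sides say that 2 is off the arc of
    \<open>h\<close>.\<close>
  moreover have "(\<exists>q\<in>\<Lambda>. brauer_mult h q = brauer_mult g h) \<longleftrightarrow>
       (\<exists>q\<in>\<Lambda>. brauer_mult h q = brauer_mult g' h)" if hT: "h \<in> tops G" for h
  proof -
    obtain i j where h: "one_arc h i j" "i \<in> {1..n - 2}" "j \<in> {1..n - 2}"
      using tops_iff hT by blast
    then show ?thesis using exchange_iff[OF h g] exchange_iff[OF h g'] by auto
  qed
  then have "inseparable G g g'" by (simp add: inseparable_def)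
  ultimately show ?thesis unfolding crossing_def G_simps using ep fp by blast
qed

end

theorem theorem20:
  fixes n :: nat and \<Lambda> \<Gamma> :: "pin set set set"
  assumes "n \<ge> 6"
    and "regular n \<Lambda>"
    and "alternating n \<Gamma>"
  shows "\<not> (brauer_monoid_on n \<Lambda> \<cong> brauer_monoid_on n \<Gamma>)"
proof
  interpret L: canonical_section n \<Lambda> using assms by unfold_locales (auto simp: regular_def)
  interpret C: canonical_section n \<Gamma> using assms by unfold_locales (auto simp: alternating_def)
  assume "brauer_monoid_on n \<Lambda> \<cong> brauer_monoid_on n \<Gamma>"
  then obtain \<phi> where \<phi>: "\<phi> \<in> iso L.G C.G" by (auto simp: is_iso_def)
  from \<phi> have "crossing L.G"
    by (rule crossing_iso) (auto intro: L.mult_closed C.alternating_crossing[OF assms(3)])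
  then show False using L.regular_not_crossing[OF assms(2)] by blast
qed

end
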